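(* For every integer $m\geq 1$, $$\begin{aligned}(2^{2m+1}-1)\,\zeta(2m+1)=&-(-1)^m\pi^{2m}\sum_{j=0}^{m}\frac{\mathcal{E}(2j)\,\psi(1-2j+2m)}{\Gamma(2j+1)\,\Gamma(1-2j+2m)}\\&+\frac{i}{\pi}\sum_{k=0}^{\infty}\frac{E_1\bigl(i\pi(k+\frac12)\bigr)-E_1\bigl(-i\pi(k+\frac12)\bigr)}{(k+\frac12)^{2m+1}}.\end{aligned}$$
   Context: $\zeta$ is the Riemann zeta function and $\psi=\Gamma'/\Gamma$ the digamma function. $\mathcal{E}(n)$ denotes the $n$-th Euler number, $1/\cosh x=\sum_{n\ge0}\mathcal{E}(n)x^n/n!$ (so $\mathcal{E}(0)=1$, $\mathcal{E}(2)=-1$, $\mathcal{E}(4)=5$). $E_1(\pm i\kappa)=\int_1^\infty v^{-1}e^{\mp i\kappa v}\,dv$ for $\kappa>0$ (improper, conditionally convergent integral). *)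

theory Defs
  imports "HOL-Analysis.Analysis"
begin

text \<open>Only meaningful for \<^term>\<open>Re s > 1\<close>, where the Dirichlet series converges; the
  analytic continuation to other arguments is not modelled.\<close>

definition zeta :: "complex \<Rightarrow> complex" where
  "zeta s = (\<Sum>n. 1 / of_nat (Suc n) powr s)"

text \<open>The Euler numbers are read off the formal power series of \<open>1 / cosh x\<close>, with
  \<open>cosh x = (exp x + exp (- x)) / 2\<close>. The expansion lemma below says that this series is the
  power series expansion of the function \<open>1 / cosh\<close> around 0.\<close>

definition euler_number :: "nat \<Rightarrow> real" where
  "euler_number n = fact n * fps_nth (inverse (fps_const (1/2) * (fps_exp 1 + fps_exp (-1)))) n"

lemma has_fps_expansion_euler_number:
  "(\<lambda>x::real. 1 / cosh x) has_fps_expansion Abs_fps (\<lambda>n. euler_number n / fact n)"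
proof -
  have "(\<lambda>x::real. inverse ((1/2) * (exp (1 * x) + exp ((-1) * x)))) has_fps_expansion
          inverse (fps_const (1/2) * (fps_exp 1 + fps_exp (-1)))"
    by (intro fps_expansion_intros) auto
  moreover have "(\<lambda>x::real. inverse ((1/2) * (exp (1 * x) + exp ((-1) * x)))) = (\<lambda>x. 1 / cosh x)"
    by (simp add: cosh_def field_simps)
  moreover have "inverse (fps_const (1/2) * (fps_exp 1 + fps_exp (-1)))
                   = Abs_fps (\<lambda>n. euler_number n / fact n)"
    by (simp add: fps_eq_iff euler_number_def)
  ultimately show ?thesis by simp
qed

lemma euler_number_small: "euler_number 0 = 1" "euler_number 2 = -1" "euler_number 4 = 5"
proof -
  define C :: "real fps" where "C = fps_const (1/2) * (fps_exp 1 + fps_exp (-1))"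
  have C: "fps_nth C n = (if even n then 1 / fact n else 0)" for n
    by (simp add: C_def)
  have inv: "inverse C * C = 1"
    by (intro inverse_mult_eq_1) (simp add: C)
  have "fps_nth (inverse C * C) n = (if n = 0 then 1 else 0)" for n
    by (subst inv) simp
  hence rec: "(\<Sum>i=0..n. fps_nth (inverse C) i * fps_nth C (n - i)) = (if n = 0 then 1 else 0)" for n
    by (simp add: fps_mult_nth)
  have E: "euler_number n = fact n * fps_nth (inverse C) n" for n
    by (simp add: euler_number_def C_def)
  have sum2: "(\<Sum>i=0..2. f i) = f 0 + f 1 + f 2"
    and sum4: "(\<Sum>i=0..4. f i) = f 0 + f 1 + f 2 + f 3 + f 4" for f :: "nat \<Rightarrow> real"
    by (simp_all add: eval_nat_numeral)
  have 0: "fps_nth (inverse C) 0 = 1"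
    using rec[of 0] by (simp add: C)
  have 2: "fps_nth (inverse C) 2 = -1/2"
    using rec[of 2] unfolding sum2 by (simp add: C 0)
  have 4: "fps_nth (inverse C) 4 = 5/24"
    using rec[of 4] unfolding sum4 by (simp add: C 0 2 fact_numeral)
  show "euler_number 0 = 1" "euler_number 2 = -1" "euler_number 4 = 5"
    by (simp_all add: E C 2 4 fact_numeral)
qed

text \<open>On the imaginary axis the integral converges only conditionally, so it is taken as the
  limit of the integrals over \<open>[1, T]\<close>. The value is meaningful for \<^term>\<open>Re z \<ge> 0\<close>,
  \<^term>\<open>z \<noteq> 0\<close>.\<close>

definition E1 :: "complex \<Rightarrow> complex" where
  "E1 z = Lim at_top (\<lambda>T::real. integral {1..T} (\<lambda>v. exp (- z * of_real v) / of_real v))"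

lemma E1_tendsto:
  assumes "Re z \<ge> 0" "z \<noteq> 0"
  shows "((\<lambda>T::real. integral {1..T} (\<lambda>v. exp (- z * of_real v) / of_real v)) \<longlongrightarrow> E1 z) at_top"
proof -
  define g :: "real \<Rightarrow> complex" where "g = (\<lambda>v. exp (- z * of_real v) / (z * of_real v ^ 2))"
  define F :: "real \<Rightarrow> complex" where "F = (\<lambda>v. - exp (- z * of_real v) / (z * of_real v))"
  have nonneg: "norm (exp (- z * of_real v)) \<le> 1" if "v \<ge> 1" for v :: real
    using that assms by simp
  have bound: "norm (g v) \<le> norm ((1 / norm z) * v powr -2)" if "v \<ge> 1" for v :: real
  proof -
    have "norm (g v) = norm (exp (- z * of_real v)) / (norm z * v ^ 2)"
      using that by (simp add: g_def norm_divide norm_mult norm_power)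
    also have "\<dots> \<le> 1 / (norm z * v ^ 2)"
      using nonneg[OF that] by (intro divide_right_mono) auto
    also have "\<dots> = norm ((1 / norm z) * v powr -2)"
      using that by (simp add: powr_minus field_simps norm_mult)
    finally show ?thesis .
  qed
  have "(\<lambda>v::real. v powr -2) absolutely_integrable_on {1..}"
    using has_integral_powr_to_inf[of "-2" 1]
    by (intro nonnegative_absolutely_integrable_1) (auto simp: integrable_on_def)
  hence "(\<lambda>v::real. (1 / norm z) * v powr -2) absolutely_integrable_on {1..}"
    by (rule set_integrable_mult_right)
  hence *: "g absolutely_integrable_on {1..}"
  proof (rule set_integrable_bound)
    have "(\<lambda>x. indicator {1..} x *\<^sub>R g x) \<in> borel_measurable borel"
      unfolding g_def using assms
      by (intro borel_measurable_continuous_on_indicator continuous_intros) auto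
    thus "set_borel_measurable lebesgue {1..} g"
      by (simp add: set_borel_measurable_def measurable_completion)
  qed (use bound in auto)
  have "((\<lambda>T. set_lebesgue_integral lebesgue {1..T} g) \<longlongrightarrow> set_lebesgue_integral lebesgue {1..} g) at_top"
    by (rule tendsto_set_lebesgue_integral_at_top) (use * in auto)
  moreover have "set_lebesgue_integral lebesgue {1..T} g = integral {1..T} g" for T
    by (intro set_lebesgue_integral_eq_integral set_integrable_subset[OF *]) auto
  ultimately have lim_g: "((\<lambda>T. integral {1..T} g) \<longlongrightarrow> set_lebesgue_integral lebesgue {1..} g) at_top"
    by simp
  have "(F \<longlongrightarrow> 0) at_top"
  proof (rule Lim_null_comparison)
    show "\<forall>\<^sub>F v in at_top. norm (F v) \<le> (1 / norm z) / v"
      using eventually_ge_at_top[of 1]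
    proof eventually_elim
      case (elim v)
      have "norm (F v) = norm (exp (- z * of_real v)) / (norm z * v)"
        using elim by (simp add: F_def norm_divide norm_mult)
      also have "\<dots> \<le> 1 / (norm z * v)"
        using nonneg[OF elim] elim by (intro divide_right_mono) auto
      finally show ?case by simp
    qed
    show "((\<lambda>v. (1 / norm z) / v) \<longlongrightarrow> 0) at_top"
      by (intro tendsto_divide_0[OF tendsto_const]) (simp add: filterlim_at_top_imp_at_infinity filterlim_ident)
  qed
  hence "((\<lambda>T. F T - F 1 - integral {1..T} g) \<longlongrightarrow> 0 - F 1 - set_lebesgue_integral lebesgue {1..} g) at_top"
    by (intro tendsto_intros lim_g)
  moreover have "\<forall>\<^sub>F T in at_top. F T - F 1 - integral {1..T} g
                   = integral {1..T} (\<lambda>v. exp (- z * of_real v) / of_real v)"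
    using eventually_ge_at_top[of 1]
  proof eventually_elim
    case (elim T)
    have "((\<lambda>v. exp (- z * of_real v) / of_real v + g v) has_integral F T - F 1) {1..T}"
    proof (rule fundamental_theorem_of_calculus)
      fix v assume "v \<in> {1..T}"
      hence "v \<noteq> 0" by auto
      define G where "G = (\<lambda>w. - exp (- z * w) / (z * w))"
      have "(G has_field_derivative exp (- z * of_real v) / of_real v + g v) (at (of_real v))"
        unfolding G_def g_def using \<open>v \<noteq> 0\<close> assms
        by (auto intro!: derivative_eq_intros simp: field_simps power2_eq_square)
      hence "((\<lambda>x. G (of_real x)) has_vector_derivative exp (- z * of_real v) / of_real v + g v) (at v within {1..T})"
        by (rule has_vector_derivative_real_field)
      thus "(F has_vector_derivative exp (- z * of_real v) / of_real v + g v) (at v within {1..T})"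
        by (simp add: G_def F_def)
    qed (use elim in auto)
    moreover have "(g has_integral integral {1..T} g) {1..T}"
      using set_integrable_subset[OF *, of "{1..T}"]
      by (intro integrable_integral set_lebesgue_integral_eq_integral) auto
    ultimately have "((\<lambda>v. exp (- z * of_real v) / of_real v + g v - g v)
                        has_integral F T - F 1 - integral {1..T} g) {1..T}"
      by (rule has_integral_diff)
    thus ?case by (simp add: integral_unique)
  qed
  ultimately have "((\<lambda>T. integral {1..T} (\<lambda>v. exp (- z * of_real v) / of_real v))
                     \<longlongrightarrow> 0 - F 1 - set_lebesgue_integral lebesgue {1..} g) at_top"
    by (rule Lim_transform_eventually)
  thus ?thesis
    unfolding E1_def using tendsto_Lim[OF trivial_limit_at_top_linorder] by fastforce
qed

end

theory Submission
  imports Defs "HOL-Probability.Sinc_Integral"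
begin

text \<open>
  Write \<open>\<kappa>\<^sub>k = \<pi> (k + 1/2)\<close>. Since
  \<open>E\<^sub>1 (i\<kappa>) - E\<^sub>1 (-i\<kappa>) = -2i \<integral>\<^sub>1\<^sup>\<infinity> sin (\<kappa>v) / v dv = -2i (\<pi>/2 - Si \<kappa>)\<close>, the exponential integral
  series splits into two parts. The constants \<open>\<pi>/2\<close> contribute \<open>\<Sum> 1 / (k + 1/2)\<^bsup>2m+1\<^esup>\<close>, which is exactly
  the left-hand side \<open>(2\<^bsup>2m+1\<^esup> - 1) \<zeta>(2m+1)\<close>, because the odd part of the zeta series is what remains
  after removing the even part. So the theorem amounts to the closed form of
  \<open>\<Sum> Si \<kappa>\<^sub>k / \<kappa>\<^sub>k\<^bsup>2m+1\<^esup>\<close> in \<open>Si_series\<close>, which must cancel the digamma sum.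

  For that closed form, \<open>Si \<kappa> = \<integral>\<^sub>0\<^sup>1 sin (\<kappa>v) / v dv\<close>, and the substitution \<open>u = 1 - v\<close> turns
  \<open>sin (\<kappa>\<^sub>k v)\<close> into \<open>(-1)\<^sup>k cos (\<kappa>\<^sub>k u)\<close>. The Fourier series \<open>\<Sum> (-1)\<^sup>k cos (\<kappa>\<^sub>k u) / \<kappa>\<^sub>k\<^bsup>2m+1\<^esup>\<close>
  is, for \<open>\<bar>u\<bar> < 1\<close>, an Euler polynomial, with coefficients \<open>w\<^sub>j = \<E>(2j) / ((2j)! (2m-2j)!)\<close> at
  \<open>u\<^bsup>2m-2j\<^esup>\<close> up to a common factor (\<open>cos_series\<close>). Comparing coefficients in \<open>sech \<cdot> cosh = 1\<close> gives
  \<open>\<Sum> w\<^sub>j = 0\<close> for \<open>m \<ge> 1\<close>, so each power may be replaced by \<open>(1 - v)\<^sup>n - 1\<close>, which is divisible by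
  \<open>v\<close>, and \<open>\<integral>\<^sub>0\<^sup>1 (1 - (1 - v)\<^sup>n) / v dv\<close> is the harmonic number \<open>H\<^sub>n = \<psi>(n+1) + \<gamma>\<close>. The same relation
  \<open>\<Sum> w\<^sub>j = 0\<close> makes the Euler--Mascheroni constants in the digamma sum disappear.

  The Fourier expansion is proved by induction on \<open>m\<close>. For \<open>m = 0\<close> the derivative of the partial sum
  is an explicit kernel, oscillating with frequency of order \<open>N\<close>, and one integration by parts shows
  that the partial sums tend to the constant \<open>1/2\<close> uniformly on compact subsets of \<open>(-1, 1)\<close>. The
  induction step integrates the series twice; the two integration constants are fixed by oddness at \<open>0\<close>
  and by the zeros of all \<open>cos (\<kappa>\<^sub>k u)\<close> at \<open>u = -1\<close>.
\<close>

section \<open>Odd multiples of half pi\<close>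

definition kappa :: "nat \<Rightarrow> real" where
  "kappa k = pi * (real k + 1/2)"

lemma kappa_pos: "kappa k > 0"
  unfolding kappa_def by (intro mult_pos_pos) auto

lemma kappa_nonzero [simp]: "kappa k \<noteq> 0"
  using kappa_pos[of k] by simp

lemma abs_kappa [simp]: "\<bar>kappa k\<bar> = kappa k"
  using kappa_pos[of k] by simp

lemma cos_kappa [simp]: "cos (kappa k) = 0"
  by (simp add: kappa_def algebra_simps cos_add)

lemma sin_kappa_minus: "sin (kappa k - x) = (-1) ^ k * cos x"
  by (simp add: kappa_def algebra_simps sin_add sin_diff cos_add)

lemma summable_inverse_kappa_power:
  assumes "p \<ge> 2"
  shows "summable (\<lambda>k. 1 / kappa k ^ p)"
proof (rule summable_comparison_test')
  show "summable (\<lambda>k. 1 / real k ^ p)"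
    using inverse_power_summable[of p, where ?'a = real] assms by (simp add: inverse_eq_divide)
  fix k :: nat assume "k \<ge> 1"
  have "1 * real k \<le> pi * (real k + 1/2)"
    using pi_gt3 by (intro mult_mono) auto
  hence "real k ^ p \<le> kappa k ^ p"
    by (intro power_mono) (auto simp: kappa_def)
  thus "norm (1 / kappa k ^ p) \<le> 1 / real k ^ p"
    using \<open>k \<ge> 1\<close> kappa_pos[of k] by (simp add: divide_simps)
qed

section \<open>The Euler polynomials of the Fourier expansion\<close>

definition euler_coeff :: "nat \<Rightarrow> real" where
  "euler_coeff j = euler_number (2 * j) / fact (2 * j)"

text \<open>This is the coefficient of \<open>x\<^bsup>2m\<^esup>\<close> in \<open>sech x \<cdot> cosh x = 1\<close>; the odd coefficients of \<open>cosh\<close> vanish,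
  so only Euler numbers of even index enter.\<close>

lemma sum_euler_coeff_eq_0:
  assumes "m \<ge> 1"
  shows "(\<Sum>j\<le>m. euler_coeff j / fact (2 * (m - j))) = 0"
proof -
  define C :: "real fps" where "C = fps_const (1/2) * (fps_exp 1 + fps_exp (-1))"
  have C: "fps_nth C n = (if even n then 1 / fact n else 0)" for n
    by (simp add: C_def)
  have coeff: "fps_nth (inverse C) (2 * j) = euler_coeff j" for j
    by (simp add: euler_coeff_def euler_number_def C_def)
  have "inverse C * C = 1"
    by (intro inverse_mult_eq_1) (simp add: C)
  hence "0 = fps_nth (inverse C * C) (2 * m)"
    using assms by simp
  also have "\<dots> = (\<Sum>i=0..2*m. fps_nth (inverse C) i * fps_nth C (2 * m - i))"
    by (simp add: fps_mult_nth)
  also have "\<dots> = (\<Sum>i\<in>(\<lambda>j. 2 * j) ` {..m}. fps_nth (inverse C) i * fps_nth C (2 * m - i))"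
    by (intro sum.mono_neutral_right) (auto simp: C elim!: evenE)
  also have "\<dots> = (\<Sum>j\<le>m. fps_nth (inverse C) (2 * j) * fps_nth C (2 * m - 2 * j))"
    by (subst sum.reindex) (auto simp: inj_on_def)
  also have "\<dots> = (\<Sum>j\<le>m. euler_coeff j / fact (2 * (m - j)))"
    by (simp add: coeff C diff_mult_distrib2)
  finally show ?thesis ..
qed

text \<open>Up to normalisation and an affine change of variable, these are the Euler polynomials of even
  degree \<open>2m\<close> and their odd antiderivatives.\<close>

definition cos_poly :: "nat \<Rightarrow> real \<Rightarrow> real" where
  "cos_poly m u = (-1) ^ m / 2 * (\<Sum>j\<le>m. euler_coeff j * (u ^ (2 * (m - j)) / fact (2 * (m - j))))"

definition sin_poly :: "nat \<Rightarrow> real \<Rightarrow> real" where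
  "sin_poly m u = (-1) ^ m / 2 *
     (\<Sum>j\<le>m. euler_coeff j * (u ^ (2 * (m - j) + 1) / fact (2 * (m - j) + 1)))"

lemma DERIV_power_div_fact:
  "((\<lambda>u::real. u ^ Suc n / fact (Suc n)) has_field_derivative u ^ n / fact n) (at u within S)"
proof -
  have "((\<lambda>u::real. u ^ Suc n / fact (Suc n)) has_field_derivative
          (real (Suc n) * u ^ n) / fact (Suc n)) (at u within S)"
    by (auto intro!: derivative_eq_intros simp del: fact_Suc of_nat_Suc power_Suc)
  also have "(real (Suc n) * u ^ n) / fact (Suc n) = u ^ n / fact n"
    unfolding fact_Suc by (simp del: of_nat_Suc)
  finally show ?thesis .
qed

lemma DERIV_sin_poly: "(sin_poly m has_field_derivative cos_poly m u) (at u within S)"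
  unfolding sin_poly_def [abs_def] cos_poly_def Suc_eq_plus1 [symmetric]
  by (intro DERIV_cmult DERIV_sum DERIV_power_div_fact)

text \<open>The summand \<open>j = m + 1\<close> is constant; splitting it off lines up the remaining ones with those of
  \<open>sin_poly m\<close> for differentiation.\<close>

lemma cos_poly_Suc:
  "cos_poly (Suc m) u = (-1) ^ Suc m / 2 *
     ((\<Sum>j\<le>m. euler_coeff j * (u ^ Suc (2 * (m - j) + 1) / fact (Suc (2 * (m - j) + 1)))) + euler_coeff (Suc m))"
proof -
  have "(\<Sum>j\<le>m. euler_coeff j * (u ^ (2 * (Suc m - j)) / fact (2 * (Suc m - j)))) =
        (\<Sum>j\<le>m. euler_coeff j * (u ^ Suc (2 * (m - j) + 1) / fact (Suc (2 * (m - j) + 1))))"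
  proof (rule sum.cong)
    fix j assume "j \<in> {..m}"
    hence "2 * (Suc m - j) = Suc (2 * (m - j) + 1)"
      by auto
    thus "euler_coeff j * (u ^ (2 * (Suc m - j)) / fact (2 * (Suc m - j))) =
          euler_coeff j * (u ^ Suc (2 * (m - j) + 1) / fact (Suc (2 * (m - j) + 1)))"
      by (simp only:)
  qed auto
  thus ?thesis
    by (simp add: cos_poly_def)
qed

lemma DERIV_cos_poly: "(cos_poly (Suc m) has_field_derivative - sin_poly m u) (at u within S)"
proof -
  have "((\<lambda>u. (-1) ^ Suc m / 2 *
     ((\<Sum>j\<le>m. euler_coeff j * (u ^ Suc (2 * (m - j) + 1) / fact (Suc (2 * (m - j) + 1)))) + euler_coeff (Suc m)))
     has_field_derivative (-1) ^ Suc m / 2 *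
     ((\<Sum>j\<le>m. euler_coeff j * (u ^ (2 * (m - j) + 1) / fact (2 * (m - j) + 1))) + 0)) (at u within S)"
    by (intro DERIV_cmult DERIV_add DERIV_const DERIV_sum DERIV_power_div_fact)
  also have "(\<lambda>u. (-1) ^ Suc m / 2 *
     ((\<Sum>j\<le>m. euler_coeff j * (u ^ Suc (2 * (m - j) + 1) / fact (Suc (2 * (m - j) + 1)))) + euler_coeff (Suc m)))
     = cos_poly (Suc m)"
    by (rule ext) (rule cos_poly_Suc [symmetric])
  also have "(-1) ^ Suc m / 2 *
     ((\<Sum>j\<le>m. euler_coeff j * (u ^ (2 * (m - j) + 1) / fact (2 * (m - j) + 1))) + 0) = - sin_poly m u"
    by (simp add: sin_poly_def)
  finally show ?thesis .
qed

lemma sin_poly_0 [simp]: "sin_poly m 0 = 0"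
  by (simp add: sin_poly_def)

lemma cos_poly_0: "cos_poly 0 u = 1 / 2"
  by (simp add: cos_poly_def euler_coeff_def euler_number_small)

lemma cos_poly_minus_1:
  assumes "m \<ge> 1"
  shows "cos_poly m (-1) = 0"
  using sum_euler_coeff_eq_0[OF assms] by (simp add: cos_poly_def)

section \<open>The Fourier expansion\<close>

text \<open>The alternating Dirichlet kernel: multiplying by \<open>2 cos (\<pi>u/2)\<close> makes the sum telescope.\<close>

lemma alternating_sin_kernel:
  "2 * cos (pi / 2 * u) * (\<Sum>k<N. (-1) ^ k * sin (kappa k * u)) = - ((-1) ^ N * sin (real N * pi * u))"
proof (induction N)
  case (Suc N)
  have "2 * cos (pi / 2 * u) * sin (kappa N * u) =
          sin (kappa N * u + pi / 2 * u) + sin (kappa N * u - pi / 2 * u)"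
    by (simp add: sin_add sin_diff)
  also have "kappa N * u + pi / 2 * u = real (Suc N) * pi * u"
    by (simp add: kappa_def algebra_simps)
  also have "kappa N * u - pi / 2 * u = real N * pi * u"
    by (simp add: kappa_def algebra_simps)
  finally have "2 * cos (pi / 2 * u) * sin (kappa N * u) = sin (real (Suc N) * pi * u) + sin (real N * pi * u)" .
  hence "2 * cos (pi / 2 * u) * ((-1) ^ N * sin (kappa N * u))
           = (-1) ^ N * (sin (real (Suc N) * pi * u) + sin (real N * pi * u))"
    by (simp add: mult_ac)
  with Suc show ?case
    unfolding sum.lessThan_Suc ring_distribs by simp
qed auto

definition cos_term :: "nat \<Rightarrow> nat \<Rightarrow> real \<Rightarrow> real" where
  "cos_term p k u = (-1) ^ k * cos (kappa k * u) / kappa k ^ p"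

definition sin_term :: "nat \<Rightarrow> nat \<Rightarrow> real \<Rightarrow> real" where
  "sin_term p k u = (-1) ^ k * sin (kappa k * u) / kappa k ^ p"

lemma DERIV_cos_term:
  "(cos_term (Suc p) k has_field_derivative - sin_term p k u) (at u within S)"
  unfolding cos_term_def [abs_def] sin_term_def
  by (auto intro!: derivative_eq_intros)

lemma DERIV_sin_term:
  "(sin_term (Suc p) k has_field_derivative cos_term p k u) (at u within S)"
  unfolding cos_term_def sin_term_def [abs_def]
  by (auto intro!: derivative_eq_intros)

lemma uniform_limit_cos_term:
  "p \<ge> 2 \<Longrightarrow> uniform_limit A (\<lambda>N u. \<Sum>k<N. cos_term p k u) (\<lambda>u. \<Sum>k. cos_term p k u) sequentially"
  using kappa_pos
  by (intro Weierstrass_m_test[OF _ summable_inverse_kappa_power])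
     (auto simp: cos_term_def abs_mult power_abs less_imp_le intro!: divide_right_mono)

lemma uniform_limit_sin_term:
  "p \<ge> 2 \<Longrightarrow> uniform_limit A (\<lambda>N u. \<Sum>k<N. sin_term p k u) (\<lambda>u. \<Sum>k. sin_term p k u) sequentially"
  using kappa_pos
  by (intro Weierstrass_m_test[OF _ summable_inverse_kappa_power])
     (auto simp: sin_term_def abs_mult power_abs less_imp_le intro!: divide_right_mono)

text \<open>This is the Leibniz series for \<open>\<pi>/4\<close>.\<close>

lemma cos_series_at_0: "(\<lambda>k. cos_term 1 k 0) sums (1/2)"
proof -
  have "summable (\<lambda>k. (-1) ^ k * 1 / real (k * 2 + 1))"
    using summable_arctan_series[of 1] by simp
  hence "(\<lambda>k. (-1) ^ k * 1 / real (k * 2 + 1)) sums (pi / 4)"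
    unfolding pi_series by (rule summable_sums)
  hence "(\<lambda>k. 2 / pi * ((-1) ^ k * 1 / real (k * 2 + 1))) sums (2 / pi * (pi / 4))"
    by (rule sums_mult)
  moreover have "2 / pi * ((-1) ^ k * 1 / real (k * 2 + 1)) = cos_term 1 k 0" for k
    by (simp add: cos_term_def kappa_def field_simps)
  ultimately show ?thesis
    by simp
qed

text \<open>The base case, where the series converges only conditionally. The derivative of the partial sum
  is \<open>\<plusminus> sin (N\<pi>u) / (2 cos (\<pi>u/2))\<close>. Adding the boundary term \<open>corr\<close> of an integration by parts
  makes this derivative \<open>O(1/N)\<close>, and \<open>corr\<close> itself is \<open>O(1/N)\<close>, both uniformly as long as
  \<open>cos (\<pi>u/2)\<close> stays away from \<open>0\<close>. So the partial sums become constant, and the value is read off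
  at \<open>u = 0\<close>.\<close>

lemma uniform_limit_cos_series_1:
  assumes a: "0 < a" "a < 1"
  shows "uniform_limit {-a..a} (\<lambda>N u. \<Sum>k<N. cos_term 1 k u) (\<lambda>_. 1/2) sequentially"
proof -
  define D where "D = (\<lambda>N u. \<Sum>k<N. cos_term 1 k u)"
  define c where "c = cos (pi / 2 * a)"
  have c: "c > 0"
    unfolding c_def using a by (intro cos_gt_zero_pi) (auto intro: order.strict_trans2[of _ 0])
  have c_le: "cos (pi / 2 * u) \<ge> c" if "u \<in> {-a..a}" for u
  proof -
    have "cos (pi / 2 * a) \<le> cos (pi / 2 * \<bar>u\<bar>)"
      using that a by (intro cos_monotone_0_pi_le) (auto simp: abs_if)
    also have "\<dots> = cos (pi / 2 * u)"
      by (simp add: abs_if)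
    finally show ?thesis by (simp add: c_def)
  qed
  define corr where "corr = (\<lambda>N u. (-1) ^ N * cos (real N * pi * u) / (2 * real N * pi * cos (pi / 2 * u)))"
  define B where "B = 1 / (4 * c\<^sup>2) * a + 1 / (pi * c)"
  have bound: "\<bar>D N u - D N 0\<bar> \<le> B / real N" if N: "N > 0" and u: "u \<in> {-a..a}" for N u
  proof -
    define Q' where "Q' = (\<lambda>u. (-1) ^ N * cos (real N * pi * u) * sin (pi / 2 * u) / (4 * real N * (cos (pi / 2 * u))\<^sup>2))"
    have deriv: "((\<lambda>u. D N u + corr N u) has_field_derivative Q' x) (at x within {-a..a})"
      if x: "x \<in> {-a..a}" for x
    proof -
      have nz: "cos (pi / 2 * x) \<noteq> 0"
        using c_le[OF x] c by simp
      have "(D N has_field_derivative (\<Sum>k<N. - sin_term 0 k x)) (at x within {-a..a})"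
        unfolding D_def using DERIV_cos_term[of 0] by (intro DERIV_sum) simp
      also have "(\<Sum>k<N. - sin_term 0 k x) = (-1) ^ N * sin (real N * pi * x) / (2 * cos (pi / 2 * x))"
        using alternating_sin_kernel[of x N] nz
        by (simp add: sin_term_def sum_negf field_simps)
      finally have D': "(D N has_field_derivative (-1) ^ N * sin (real N * pi * x) / (2 * cos (pi / 2 * x))) (at x within {-a..a})" .
      have "(corr N has_field_derivative
              - ((-1) ^ N * sin (real N * pi * x) / (2 * cos (pi / 2 * x))) + Q' x) (at x within {-a..a})"
        unfolding corr_def Q'_def using nz N
        by (auto intro!: derivative_eq_intros simp: field_simps power2_eq_square)
      from DERIV_add[OF D' this] show ?thesis by simp
    qed
    have Q'_bound: "norm (Q' x) \<le> 1 / (4 * c\<^sup>2) / real N" if x: "x \<in> {-a..a}" for x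
    proof -
      have "norm (Q' x) = \<bar>cos (real N * pi * x)\<bar> * \<bar>sin (pi / 2 * x)\<bar> / (4 * real N * (cos (pi / 2 * x))\<^sup>2)"
        by (simp add: Q'_def abs_mult power_abs)
      also have "\<dots> \<le> 1 * 1 / (4 * real N * c\<^sup>2)"
        using c_le[OF x] c N by (intro frac_le mult_mono mult_left_mono power_mono) auto
      finally show ?thesis by (simp add: mult_ac)
    qed
    have "norm ((D N u + corr N u) - (D N 0 + corr N 0)) \<le> 1 / (4 * c\<^sup>2) / real N * norm (u - 0)"
      by (rule field_differentiable_bound[OF _ deriv Q'_bound]) (use u a in auto)
    also have "\<dots> \<le> 1 / (4 * c\<^sup>2) / real N * a"
      using u c by (intro mult_left_mono) auto
    finally have 1: "\<bar>(D N u + corr N u) - (D N 0 + corr N 0)\<bar> \<le> 1 / (4 * c\<^sup>2) / real N * a"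
      by simp
    have 2: "\<bar>corr N x\<bar> \<le> 1 / (2 * real N * pi * c)" if x: "x \<in> {-a..a}" for x
    proof -
      have "\<bar>corr N x\<bar> = \<bar>cos (real N * pi * x)\<bar> / (2 * real N * pi * cos (pi / 2 * x))"
        using c_le[OF x] c by (simp add: corr_def abs_mult power_abs)
      also have "\<dots> \<le> 1 / (2 * real N * pi * c)"
        using c_le[OF x] c N by (intro frac_le mult_left_mono) auto
      finally show ?thesis .
    qed
    have "\<bar>D N u - D N 0\<bar> \<le> 1 / (4 * c\<^sup>2) / real N * a + (1 / (2 * real N * pi * c) + 1 / (2 * real N * pi * c))"
    proof -
      have "0 \<in> {-a..a}"
        using a by simp
      from 1 2[OF u] 2[OF this] show ?thesis
        by linarith
    qed
    also have "\<dots> = B / real N"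
      using N c by (simp add: B_def field_simps)
    finally show ?thesis .
  qed
  have "uniform_limit {-a..a} (\<lambda>N u. D N u - D N 0) (\<lambda>_. 0) sequentially"
  proof (rule uniform_limit_null_comparison)
    show "\<forall>\<^sub>F N in sequentially. \<forall>u\<in>{-a..a}. norm (D N u - D N 0) \<le> B / real N"
      using eventually_gt_at_top[of 0] by eventually_elim (use bound in auto)
    have "(\<lambda>N. B / real N) \<longlonglongrightarrow> 0"
      by (rule lim_const_over_n)
    thus "uniform_limit {-a..a} (\<lambda>N u. B / real N) (\<lambda>_. 0) sequentially"
      by (auto simp: uniform_limit_iff tendsto_iff elim: eventually_mono)
  qed
  moreover have "uniform_limit {-a..a} (\<lambda>N u. D N 0) (\<lambda>_. 1/2) sequentially"
    using cos_series_at_0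
    by (auto simp: uniform_limit_iff tendsto_iff sums_def D_def elim: eventually_mono)
  ultimately have "uniform_limit {-a..a} (\<lambda>N u. (D N u - D N 0) + D N 0) (\<lambda>_. 0 + 1/2) sequentially"
    by (rule uniform_limit_add)
  thus ?thesis by (simp add: D_def)
qed

text \<open>First half of the induction step: integrate from \<open>0\<close>, where both sides vanish. The uniform limit
  is assumed only on compact subsets of \<open>(-1, 1)\<close>: at \<open>u = \<plusminus>1\<close> every term vanishes, whereas
  \<open>cos_poly 0\<close> is \<open>1/2\<close> throughout.\<close>

lemma sin_series_eq_sin_poly:
  assumes "\<And>a. 0 < a \<Longrightarrow> a < 1 \<Longrightarrow>
    uniform_limit {-a..a} (\<lambda>N u. \<Sum>k<N. cos_term p k u) (cos_poly m) sequentially"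
  assumes u: "\<bar>u\<bar> < 1"
  shows "(\<lambda>k. sin_term (Suc p) k u) sums sin_poly m u"
proof -
  obtain a where a: "\<bar>u\<bar> < a" "a < 1"
    using u dense by blast
  have "\<exists>g. \<forall>x\<in>{-a..a}. (\<lambda>k. sin_term (Suc p) k x) sums g x \<and>
               (g has_field_derivative cos_poly m x) (at x within {-a..a})"
    by (rule has_field_derivative_series[where ?x0.0 = 0, OF _ DERIV_sin_term assms(1)])
       (use a in \<open>auto simp: sin_term_def\<close>)
  then obtain g where g:
      "\<And>x. x \<in> {-a..a} \<Longrightarrow> (\<lambda>k. sin_term (Suc p) k x) sums g x"
      "\<And>x. x \<in> {-a..a} \<Longrightarrow> (g has_field_derivative cos_poly m x) (at x within {-a..a})"
    by blast
  have "((\<lambda>x. g x - sin_poly m x) has_field_derivative 0) (at x within {-a..a})"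
    if "x \<in> {-a..a}" for x
    using DERIV_diff[OF g(2)[OF that] DERIV_sin_poly[of m x "{-a..a}"]] by simp
  then obtain c where c: "\<And>x. x \<in> {-a..a} \<Longrightarrow> g x - sin_poly m x = c"
    using has_field_derivative_zero_constant[of "{-a..a}" "\<lambda>x. g x - sin_poly m x"] by auto
  have "g 0 = 0"
    using g(1)[of 0] a by (simp add: sin_term_def sums_iff)
  with c[of 0] a have "c = 0"
    by simp
  moreover have "u \<in> {-a..a}"
    using a by auto
  ultimately show ?thesis
    using c[of u] g(1)[of u] by auto
qed

text \<open>Second half of the induction step. The cosine series now converges uniformly on the whole line, so
  its sum is continuous up to the end point \<open>-1\<close>, where every term and the polynomial are \<open>0\<close>;
  this fixes the second integration constant.\<close>

lemma cos_series_eq_cos_poly_Suc: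
  assumes sin: "\<And>u. \<bar>u\<bar> < 1 \<Longrightarrow> (\<lambda>k. sin_term p k u) sums sin_poly m u"
  assumes p: "p \<ge> 2" and u: "u \<in> {-1..1}"
  shows "(\<Sum>k. cos_term (Suc p) k u) = cos_poly (Suc m) u"
proof -
  define f where "f = (\<lambda>u. \<Sum>k. cos_term (Suc p) k u)"
  have "uniform_limit UNIV (\<lambda>N u. \<Sum>k<N. cos_term (Suc p) k u) f sequentially"
    unfolding f_def using p by (intro uniform_limit_cos_term) auto
  hence cont: "continuous_on UNIV f"
    by (rule uniform_limit_theorem[rotated])
       (auto simp: cos_term_def intro!: always_eventually continuous_intros)
  have deriv: "(f has_field_derivative - sin_poly m x) (at x)" if x: "-1 < x" "x < 1" for x
  proof -
    have lim: "uniformly_convergent_on UNIV (\<lambda>N u. \<Sum>k<N. - sin_term p k u)"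
      using uniform_limit_uminus[OF uniform_limit_sin_term[OF p]]
      by (auto simp: uniformly_convergent_on_def sum_negf)
    have "(f has_field_derivative (\<Sum>k. - sin_term p k x)) (at x)"
      unfolding f_def
      by (rule has_field_derivative_series'(2)[where ?x0.0 = 1, OF _ DERIV_cos_term lim])
         (auto simp: cos_term_def)
    moreover have "(\<Sum>k. - sin_term p k x) = - sin_poly m x"
      using sums_minus[OF sin[of x]] x by (simp add: sums_iff)
    ultimately show ?thesis by simp
  qed
  have "f u - cos_poly (Suc m) u = f (-1) - cos_poly (Suc m) (-1)"
  proof (rule DERIV_isconst2[where a = "-1" and b = 1])
    show "continuous_on {-1..1} (\<lambda>u. f u - cos_poly (Suc m) u)"
      by (intro continuous_intros continuous_on_subset[OF cont] DERIV_continuous_on[OF DERIV_cos_poly]) auto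
    show "DERIV (\<lambda>u. f u - cos_poly (Suc m) u) x :> 0" if "-1 < x" "x < 1" for x
      using DERIV_diff[OF deriv[OF that] DERIV_cos_poly[of m x UNIV]] by simp
  qed (use u in auto)
  also have "f (-1) = 0"
    by (simp add: f_def cos_term_def)
  also have "cos_poly (Suc m) (-1) = 0"
    by (rule cos_poly_minus_1) simp
  finally show ?thesis
    by (simp add: f_def)
qed

lemma uniform_limit_cos_series:
  assumes "0 < a" "a < 1"
  shows "uniform_limit {-a..a} (\<lambda>N u. \<Sum>k<N. cos_term (2 * m + 1) k u) (cos_poly m) sequentially"
  using assms
proof (induction m arbitrary: a)
  case 0
  thus ?case
    using uniform_limit_cos_series_1[of a] by (simp add: cos_poly_0 [abs_def])
next
  case (Suc m)
  have "(\<Sum>k. cos_term (Suc (2 * m + 2)) k u) = cos_poly (Suc m) u" if "u \<in> {-a..a}" for u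
    using sin_series_eq_sin_poly[OF Suc.IH] that Suc.prems
    by (intro cos_series_eq_cos_poly_Suc) auto
  moreover have "uniform_limit {-a..a} (\<lambda>N u. \<Sum>k<N. cos_term (Suc (2 * m + 2)) k u)
                   (\<lambda>u. \<Sum>k. cos_term (Suc (2 * m + 2)) k u) sequentially"
    by (rule uniform_limit_cos_term) simp
  ultimately have "uniform_limit {-a..a} (\<lambda>N u. \<Sum>k<N. cos_term (Suc (2 * m + 2)) k u)
                     (cos_poly (Suc m)) sequentially"
    by (subst (asm) uniform_limit_cong') auto
  thus ?case by simp
qed

lemma cos_series:
  assumes "\<bar>u\<bar> < 1"
  shows "(\<lambda>k. cos_term (2 * m + 1) k u) sums cos_poly m u"
proof -
  obtain a where a: "\<bar>u\<bar> < a" "a < 1"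
    using assms dense by blast
  have "uniform_limit {-a..a} (\<lambda>N u. \<Sum>k<N. cos_term (2 * m + 1) k u) (cos_poly m) sequentially"
    by (rule uniform_limit_cos_series) (use a in auto)
  thus ?thesis
    unfolding sums_def by (rule tendsto_uniform_limitI) (use a in auto)
qed

section \<open>The series of sine integrals\<close>

lemma abs_sinc_le_1: "\<bar>sinc x\<bar> \<le> 1"
  using abs_sin_x_le_abs_x[of x] by (auto simp: divide_le_eq_1)

lemma has_integral_sinc:
  assumes "x \<noteq> 0" "a \<le> b"
  shows "((\<lambda>v. sinc (x * v)) has_integral (Si (x * b) - Si (x * a)) / x) {a..b}"
proof -
  have "((\<lambda>v. Si (x * v) / x) has_field_derivative sinc (x * v)) (at v within {a..b})" for v
  proof -
    have "((\<lambda>v. Si (x * v)) has_field_derivative sinc (x * v) * (x * 1)) (at v within {a..b})"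
      by (rule DERIV_chain2[OF DERIV_Si]) (auto intro!: derivative_eq_intros)
    from DERIV_cdivide[OF this, of x] assms show ?thesis by simp
  qed
  hence "((\<lambda>v. sinc (x * v)) has_integral (Si (x * b) / x - Si (x * a) / x)) {a..b}"
    using assms
    by (intro fundamental_theorem_of_calculus) (auto simp flip: has_real_derivative_iff_has_vector_derivative)
  thus ?thesis
    by (simp add: diff_divide_distrib)
qed

text \<open>The integrand is \<open>(1 - (1 - v)\<^sup>n) / v\<close> with the singularity at \<open>0\<close> removed.\<close>

lemma has_integral_geometric_sum:
  "((\<lambda>v::real. \<Sum>i<n. (1 - v) ^ i) has_integral harm n) {0..1}"
proof -
  have "((\<lambda>v::real. (1 - v) ^ i) has_integral
          (- ((1 - 1) ^ Suc i / real (Suc i)) - (- ((1 - 0) ^ Suc i / real (Suc i))))) {0..1}" for i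
  proof (rule fundamental_theorem_of_calculus)
    fix v :: real
    have "((\<lambda>v. - ((1 - v) ^ Suc i / real (Suc i))) has_real_derivative (1 - v) ^ i) (at v within {0..1})"
      by (auto intro!: derivative_eq_intros simp del: of_nat_Suc power_Suc)
    thus "((\<lambda>v. - ((1 - v) ^ Suc i / real (Suc i))) has_vector_derivative (1 - v) ^ i) (at v within {0..1})"
      by (simp only: has_real_derivative_iff_has_vector_derivative)
  qed auto
  hence "((\<lambda>v::real. (1 - v) ^ i) has_integral inverse (real (Suc i))) {0..1}" for i
    by (simp add: inverse_eq_divide)
  hence "((\<lambda>v::real. \<Sum>i<n. (1 - v) ^ i) has_integral (\<Sum>i<n. inverse (real (Suc i)))) {0..1}"
    by (intro has_integral_sum) auto
  also have "(\<Sum>i<n. inverse (real (Suc i))) = harm n"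
    by (rule harm_altdef [symmetric])
  finally show ?thesis .
qed

definition euler_harm_sum :: "nat \<Rightarrow> real" where
  "euler_harm_sum m = (\<Sum>j\<le>m. euler_coeff j / fact (2 * (m - j)) * harm (2 * (m - j)))"

text \<open>Writing \<open>Si \<kappa> / \<kappa>\<close> as the integral of \<open>sinc (\<kappa>v)\<close> over \<open>[0, 1]\<close> leaves the factor \<open>1 / \<kappa>\<^bsup>2m\<^esup>\<close>
  outside, which for \<open>m \<ge> 1\<close> dominates the series uniformly, so it may be integrated term by term.
  For \<open>v \<noteq> 0\<close> the integrand sums to \<open>cos_poly m (1 - v) / v\<close>; the removable singularity there is
  cleared by \<open>sum_euler_coeff_eq_0\<close>.\<close>

lemma Si_series:
  assumes m: "m \<ge> 1"
  shows "(\<lambda>k. Si (kappa k) / kappa k ^ (2 * m + 1)) sums (- ((-1) ^ m / 2 * euler_harm_sum m))"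
proof -
  define f where "f = (\<lambda>k v. sinc (kappa k * v) / kappa k ^ (2 * m))"
  define w where "w = (\<lambda>j. euler_coeff j / fact (2 * (m - j)))"
  define P where "P = (\<lambda>v::real. - ((-1) ^ m / 2 * (\<Sum>j\<le>m. w j * (\<Sum>i<2 * (m - j). (1 - v) ^ i))))"

  have f_integral: "(f k has_integral Si (kappa k) / kappa k ^ (2 * m + 1)) {0..1}" for k
  proof -
    have "Si 0 = 0"
      using Si_neg[of 0] by simp
    hence "((\<lambda>v. sinc (kappa k * v)) has_integral Si (kappa k) / kappa k) {0..1}"
      using has_integral_sinc[of "kappa k" 0 1] by simp
    from has_integral_divide[OF this, of "kappa k ^ (2 * m)"] show ?thesis
      by (simp add: f_def)
  qed

  have lim: "uniform_limit {0..1} (\<lambda>N v. \<Sum>k<N. f k v) (\<lambda>v. \<Sum>k. f k v) sequentially"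
  proof (rule Weierstrass_m_test)
    show "summable (\<lambda>k. 1 / kappa k ^ (2 * m))"
      using m by (intro summable_inverse_kappa_power) auto
    show "norm (f k v) \<le> 1 / kappa k ^ (2 * m)" for k v
    proof -
      have "norm (f k v) = \<bar>sinc (kappa k * v)\<bar> / kappa k ^ (2 * m)"
        by (simp only: f_def real_norm_def abs_divide power_abs abs_kappa)
      also have "\<dots> \<le> 1 / kappa k ^ (2 * m)"
        by (intro divide_right_mono abs_sinc_le_1) (simp add: less_imp_le[OF kappa_pos])
      finally show ?thesis .
    qed
  qed
  have cont: "continuous_on {0..1} (\<lambda>v. \<Sum>k<N. f k v)" for N
    unfolding f_def
    by (intro continuous_on_sum continuous_on_divide continuous_on_sinc continuous_intros) auto
  obtain I J where IJ:
      "\<And>N. ((\<lambda>v. \<Sum>k<N. f k v) has_integral I N) {0..1}"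
      "((\<lambda>v. \<Sum>k. f k v) has_integral J) {0..1}" "I \<longlonglongrightarrow> J"
    using uniform_limit_integral[OF lim cont] by auto
  have "I N = (\<Sum>k<N. Si (kappa k) / kappa k ^ (2 * m + 1))" for N
    by (rule has_integral_unique[OF IJ(1)]) (intro has_integral_sum f_integral, auto)
  hence "I = (\<lambda>N. \<Sum>k<N. Si (kappa k) / kappa k ^ (2 * m + 1))"
    by (rule ext)
  with IJ(3) have sums_J: "(\<lambda>k. Si (kappa k) / kappa k ^ (2 * m + 1)) sums J"
    by (simp add: sums_def)

  \<comment> \<open>At \<open>v = 0\<close> the substitution \<open>u = 1 - v\<close> leaves the open interval of the Fourier expansion.\<close>
  have f_sums: "(\<Sum>k. f k v) = P v" if v: "v \<in> {0..1} - {0}" for v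
  proof -
    have "cos_poly m (1 - v) = (-1) ^ m / 2 * (\<Sum>j\<le>m. w j * (1 - v) ^ (2 * (m - j)))"
      by (simp add: cos_poly_def w_def)
    also have "(\<Sum>j\<le>m. w j * (1 - v) ^ (2 * (m - j)))
                 = (\<Sum>j\<le>m. w j * (1 - v) ^ (2 * (m - j))) - (\<Sum>j\<le>m. w j)"
      using sum_euler_coeff_eq_0[OF m] by (simp add: w_def)
    also have "\<dots> = (\<Sum>j\<le>m. - (w j * (1 - (1 - v) ^ (2 * (m - j)))))"
      by (simp add: sum_subtractf algebra_simps)
    also have "\<dots> = (\<Sum>j\<le>m. - (w j * (v * (\<Sum>i<2 * (m - j). (1 - v) ^ i))))"
      by (subst one_diff_power_eq) simp
    finally have poly: "cos_poly m (1 - v) = v * P v"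
      by (simp add: P_def sum_negf sum_distrib_left mult_ac)
    have "(\<lambda>k. cos_term (2 * m + 1) k (1 - v) / v) sums (cos_poly m (1 - v) / v)"
      using v by (intro sums_divide cos_series) auto
    moreover have "cos_term (2 * m + 1) k (1 - v) / v = f k v" for k
    proof -
      have "sin (kappa k * v) = (-1) ^ k * cos (kappa k * (1 - v))"
        using sin_kappa_minus[of k "kappa k * (1 - v)"] by (simp add: algebra_simps)
      thus ?thesis
        using v by (simp add: f_def cos_term_def)
    qed
    ultimately show ?thesis
      using v poly by (simp add: sums_iff)
  qed
  have "(P has_integral J) {0..1}"
    by (rule has_integral_spike_finite[OF _ _ IJ(2), of "{0}"]) (use f_sums in auto)
  moreover have "(P has_integral - ((-1) ^ m / 2 * (\<Sum>j\<le>m. w j * harm (2 * (m - j))))) {0..1}"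
    unfolding P_def
    by (intro has_integral_neg has_integral_mult_right has_integral_sum has_integral_geometric_sum) auto
  ultimately have "J = - ((-1) ^ m / 2 * euler_harm_sum m)"
    unfolding euler_harm_sum_def w_def by (rule has_integral_unique)
  with sums_J show ?thesis by simp
qed

section \<open>Exponential integrals, zeta and digamma values\<close>

text \<open>The real parts of the two integrands cancel, which leaves \<open>-2i sin (xv) / v\<close>; its integral over
  \<open>[1, \<infinity>)\<close> is a tail of the Dirichlet integral.\<close>

lemma E1_imaginary_diff:
  assumes x: "x > 0"
  shows "E1 (\<i> * of_real x) - E1 (- (\<i> * of_real x)) = - 2 * \<i> * of_real (pi / 2 - Si x)"
proof -
  define F where "F = (\<lambda>z T. integral {1..T} (\<lambda>v::real. exp (- z * of_real v) / of_real v) :: complex)"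
  have "((\<lambda>T. F (\<i> * of_real x) T - F (- (\<i> * of_real x)) T) \<longlongrightarrow> E1 (\<i> * of_real x) - E1 (- (\<i> * of_real x))) at_top"
    unfolding F_def using x by (intro tendsto_diff E1_tendsto) auto
  moreover have "((\<lambda>T. F (\<i> * of_real x) T - F (- (\<i> * of_real x)) T) \<longlongrightarrow> - 2 * \<i> * of_real (pi / 2 - Si x)) at_top"
  proof (rule Lim_transform_eventually)
    have "filterlim (\<lambda>T. x * T) at_top at_top"
      using x by (intro filterlim_tendsto_pos_mult_at_top[OF tendsto_const] filterlim_ident)
    from filterlim_compose[OF Si_at_top this]
    show "((\<lambda>T. - 2 * \<i> * of_real (Si (x * T) - Si x)) \<longlongrightarrow> - 2 * \<i> * of_real (pi / 2 - Si x)) at_top"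
      by (intro tendsto_intros)
    show "\<forall>\<^sub>F T in at_top. - 2 * \<i> * of_real (Si (x * T) - Si x) = F (\<i> * of_real x) T - F (- (\<i> * of_real x)) T"
      using eventually_ge_at_top[of 1]
    proof eventually_elim
      case (elim T)
      have "((\<lambda>v. x * sinc (x * v)) has_integral x * ((Si (x * T) - Si (x * 1)) / x)) {1..T}"
        using has_integral_sinc[of x 1 T] x elim by (intro has_integral_mult_right) auto
      hence "((\<lambda>v. of_real (x * sinc (x * v)) :: complex) has_integral of_real (x * ((Si (x * T) - Si (x * 1)) / x))) {1..T}"
        by (rule has_integral_of_real)
      hence "((\<lambda>v. - 2 * \<i> * of_real (x * sinc (x * v))) has_integral - 2 * \<i> * of_real (Si (x * T) - Si x)) {1..T}"
        using x by (intro has_integral_mult_right) simp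
      also have "?this \<longleftrightarrow> ((\<lambda>v. exp (- (\<i> * of_real x) * of_real v) / of_real v
                     - exp (- (- (\<i> * of_real x)) * of_real v) / of_real v) has_integral
                     - 2 * \<i> * of_real (Si (x * T) - Si x)) {1..T}"
      proof (rule has_integral_cong)
        fix v assume v: "v \<in> {1..T}"
        have "exp (- (\<i> * of_real x) * of_real v) - exp (- (- (\<i> * of_real x)) * of_real v)
                = cis (- (x * v)) - cis (x * v)"
          by (simp add: cis_conv_exp mult_ac)
        also have "\<dots> = - 2 * \<i> * of_real (sin (x * v))"
          by (simp add: complex_eq_iff)
        finally show "- 2 * \<i> * of_real (x * sinc (x * v)) =
            exp (- (\<i> * of_real x) * of_real v) / of_real v - exp (- (- (\<i> * of_real x)) * of_real v) / of_real v"
          using v x by (simp flip: diff_divide_distrib)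
      qed
      finally have "integral {1..T} (\<lambda>v. exp (- (\<i> * of_real x) * of_real v) / of_real v
                     - exp (- (- (\<i> * of_real x)) * of_real v) / of_real v) = - 2 * \<i> * of_real (Si (x * T) - Si x)"
        by (rule integral_unique)
      thus ?case
        unfolding F_def
        by (subst (asm) integral_diff) (auto intro!: integrable_continuous_interval continuous_intros)
    qed
  qed
  ultimately show ?thesis
    by (rule tendsto_unique[rotated]) simp
qed

text \<open>Pairing the terms \<open>2n + 1\<close> and \<open>2n + 2\<close> of the zeta series and subtracting the even ones, which sum to
  \<open>\<zeta>(s) / 2\<^sup>s\<close>, leaves the odd ones. The limit is asserted to be real because it is combined with
  the real series of sine integrals.\<close>

lemma half_integer_series:
  assumes s: "s \<ge> 2"
  obtains L :: real where
    "(\<lambda>k. 1 / (real k + 1/2) ^ s) sums L" "(2 ^ s - 1) * zeta (of_nat s) = of_real L"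
proof -
  define a where "a = (\<lambda>n. 1 / real (Suc n) ^ s)"
  define Z where "Z = suminf a"
  have "summable (\<lambda>n. 1 / real n ^ s)"
    using inverse_power_summable[of s, where ?'a = real] s by (simp add: inverse_eq_divide)
  hence "summable a"
    unfolding a_def by (subst summable_Suc_iff)
  hence a: "a sums Z"
    by (simp add: Z_def summable_sums)
  have "zeta (of_nat s) = (\<Sum>n. of_real (a n))"
    unfolding zeta_def a_def by (intro suminf_cong) (simp add: powr_nat' del: of_nat_Suc)
  also have "\<dots> = of_real Z"
    using sums_unique[OF sums_of_real[OF a, where ?'a = complex]] by simp
  finally have Z: "zeta (of_nat s) = of_real Z" .
  have "(\<lambda>n. sum a {n * 2..<n * 2 + 2}) sums Z"
    using a by (rule sums_group) simp
  hence "(\<lambda>n. sum a {n * 2..<n * 2 + 2} - a n / 2 ^ s) sums (Z - Z / 2 ^ s)"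
    by (intro sums_diff sums_divide a)
  also have "(\<lambda>n. sum a {n * 2..<n * 2 + 2} - a n / 2 ^ s) = (\<lambda>n. 1 / (real n + 1/2) ^ s / 2 ^ s)"
  proof
    fix n
    have "{n * 2..<n * 2 + 2} = {2 * n, Suc (2 * n)}"
      by auto
    hence "sum a {n * 2..<n * 2 + 2} = a (2 * n) + a (Suc (2 * n))"
      by simp
    also have "a (Suc (2 * n)) = a n / 2 ^ s"
    proof -
      have "real (Suc (Suc (2 * n))) = real (Suc n) * 2" by simp
      thus ?thesis by (simp only: a_def power_mult_distrib) simp
    qed
    also have "a (2 * n) = 1 / (real n + 1/2) ^ s / 2 ^ s"
    proof -
      have "real (Suc (2 * n)) = (real n + 1/2) * 2" by simp
      thus ?thesis by (simp only: a_def power_mult_distrib) simp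
    qed
    finally show "sum a {n * 2..<n * 2 + 2} - a n / 2 ^ s = 1 / (real n + 1/2) ^ s / 2 ^ s" by simp
  qed
  finally have "(\<lambda>n. 2 ^ s * (1 / (real n + 1/2) ^ s / 2 ^ s)) sums (2 ^ s * (Z - Z / 2 ^ s))"
    by (rule sums_mult)
  hence "(\<lambda>n. 1 / (real n + 1/2) ^ s) sums ((2 ^ s - 1) * Z)"
    by (simp add: algebra_simps)
  with that Z show ?thesis by simp
qed

text \<open>\<open>\<psi>(n+1) = H\<^sub>n - \<gamma>\<close>, and the total weight of \<open>\<gamma>\<close> is the vanishing sum of
  \<open>sum_euler_coeff_eq_0\<close>.\<close>

lemma digamma_sum:
  assumes m: "m \<ge> 1"
  shows "(\<Sum>j=0..m. of_real (euler_number (2 * j)) * Digamma (1 - 2 * of_nat j + 2 * of_nat m)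
              / (Gamma (2 * of_nat j + 1) * Gamma (1 - 2 * of_nat j + 2 * of_nat m)))
           = (of_real (euler_harm_sum m) :: complex)"
proof -
  define w where "w = (\<lambda>j. euler_coeff j / fact (2 * (m - j)))"
  have "(\<Sum>j=0..m. of_real (euler_number (2 * j)) * Digamma (1 - 2 * of_nat j + 2 * of_nat m)
              / (Gamma (2 * of_nat j + 1) * Gamma (1 - 2 * of_nat j + 2 * of_nat m)))
           = (\<Sum>j\<le>m. of_real (w j * (harm (2 * (m - j)) - euler_mascheroni)) :: complex)"
    unfolding atLeast0AtMost
  proof (rule sum.cong)
    fix j assume "j \<in> {..m}"
    hence arg: "1 - 2 * of_nat j + 2 * of_nat m = (of_nat (Suc (2 * (m - j))) :: complex)"
      by (simp add: of_nat_diff algebra_simps)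
    have "Gamma (2 * of_nat j + 1) = (fact (2 * j) :: complex)"
      using Gamma_fact[of "2 * j", where ?'a = complex] by (simp add: add.commute)
    moreover have "Gamma (of_nat (Suc (2 * (m - j)))) = (fact (2 * (m - j)) :: complex)"
      using Gamma_fact[of "2 * (m - j)", where ?'a = complex] by simp
    moreover have "Digamma (of_nat (Suc (2 * (m - j)))) = (of_real (harm (2 * (m - j)) - euler_mascheroni) :: complex)"
      unfolding Digamma_of_nat by (simp add: of_real_harm)
    ultimately show "of_real (euler_number (2 * j)) * Digamma (1 - 2 * of_nat j + 2 * of_nat m)
              / (Gamma (2 * of_nat j + 1) * Gamma (1 - 2 * of_nat j + 2 * of_nat m))
           = (of_real (w j * (harm (2 * (m - j)) - euler_mascheroni)) :: complex)"
      unfolding arg by (simp add: w_def euler_coeff_def del: of_nat_Suc)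
  qed auto
  also have "\<dots> = of_real (\<Sum>j\<le>m. w j * (harm (2 * (m - j)) - euler_mascheroni))"
    by simp
  also have "(\<Sum>j\<le>m. w j * (harm (2 * (m - j)) - euler_mascheroni))
               = (\<Sum>j\<le>m. w j * harm (2 * (m - j))) - (\<Sum>j\<le>m. w j) * euler_mascheroni"
    by (simp add: algebra_simps sum_subtractf sum_distrib_left sum_distrib_right)
  also have "\<dots> = euler_harm_sum m"
    using sum_euler_coeff_eq_0[OF m] by (simp add: w_def euler_harm_sum_def)
  finally show ?thesis .
qed

section \<open>The formula for odd zeta values\<close>

theorem mainTheorem5:
  fixes m :: nat
  assumes "m \<ge> 1"
  shows
    "summable (\<lambda>k::nat.
        (E1 (\<i> * of_real pi * (of_nat k + 1/2)) - E1 (- \<i> * of_real pi * (of_nat k + 1/2)))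
          / (of_nat k + 1/2) ^ (2 * m + 1)) \<and>
     (2 ^ (2 * m + 1) - 1) * zeta (of_nat (2 * m + 1)) =
       - ((-1) ^ m * of_real pi ^ (2 * m) *
           (\<Sum>j=0..m. of_real (euler_number (2 * j)) * Digamma (1 - 2 * of_nat j + 2 * of_nat m)
              / (Gamma (2 * of_nat j + 1) * Gamma (1 - 2 * of_nat j + 2 * of_nat m))))
       + \<i> / of_real pi *
           (\<Sum>k::nat.
              (E1 (\<i> * of_real pi * (of_nat k + 1/2)) - E1 (- \<i> * of_real pi * (of_nat k + 1/2)))
                / (of_nat k + 1/2) ^ (2 * m + 1))"
proof -
  define t :: "nat \<Rightarrow> complex" where
    "t = (\<lambda>k. (E1 (\<i> * of_real pi * (of_nat k + 1/2)) - E1 (- \<i> * of_real pi * (of_nat k + 1/2)))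
            / (of_nat k + 1/2) ^ (2 * m + 1))"
  define p where "p = 2 * m + 1"
  define H where "H = euler_harm_sum m"
  obtain L where L: "(\<lambda>k. 1 / (real k + 1/2) ^ p) sums L" "(2 ^ p - 1) * zeta (of_nat p) = of_real L"
    using half_integer_series[of p] assms unfolding p_def by auto
  have t: "t k = - 2 * \<i> * of_real (pi / 2 * (1 / (real k + 1/2) ^ p) - pi ^ p * (Si (kappa k) / kappa k ^ p))" for k
  proof -
    have "E1 (\<i> * of_real pi * (of_nat k + 1/2)) - E1 (- \<i> * of_real pi * (of_nat k + 1/2))
            = E1 (\<i> * of_real (kappa k)) - E1 (- (\<i> * of_real (kappa k)))"
      by (simp add: kappa_def mult_ac)
    also have "\<dots> = - 2 * \<i> * of_real (pi / 2 - Si (kappa k))"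
      by (rule E1_imaginary_diff[OF kappa_pos])
    finally have "t k = - 2 * \<i> * of_real (pi / 2 - Si (kappa k)) / of_real ((real k + 1/2) ^ p)"
      by (simp add: t_def p_def)
    also have "\<dots> = - 2 * \<i> * of_real ((pi / 2 - Si (kappa k)) / (real k + 1/2) ^ p)"
      by (simp only: of_real_divide times_divide_eq_right)
    also have "(pi / 2 - Si (kappa k)) / (real k + 1/2) ^ p
                 = pi / 2 * (1 / (real k + 1/2) ^ p) - pi ^ p * (Si (kappa k) / kappa k ^ p)"
    proof -
      have "kappa k ^ p = pi ^ p * (real k + 1/2) ^ p"
        by (simp add: kappa_def power_mult_distrib)
      thus ?thesis by (simp add: diff_divide_distrib)
    qed
    finally show ?thesis .
  qed
  define R where "R = pi / 2 * L - pi ^ p * (- ((-1) ^ m / 2 * H))"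
  have "(\<lambda>k. pi / 2 * (1 / (real k + 1/2) ^ p) - pi ^ p * (Si (kappa k) / kappa k ^ p)) sums R"
    using Si_series[OF assms] unfolding R_def H_def p_def [symmetric]
    by (intro sums_diff sums_mult L)
  hence "t sums (- 2 * \<i> * of_real R)"
    unfolding t [abs_def] by (intro sums_mult sums_of_real)
  hence summable: "summable t" and sum: "suminf t = - 2 * \<i> * of_real R"
    by (simp_all add: sums_iff)
  have "\<i> / of_real pi * suminf t = of_real (2 / pi * R)"
    by (simp add: sum field_simps)
  also have "2 / pi * R = L + (-1) ^ m * pi ^ (2 * m) * H"
    by (simp add: R_def p_def field_simps)
  finally have "\<i> / of_real pi * suminf t = of_real L + (-1) ^ m * of_real pi ^ (2 * m) * of_real H"
    by simp
  hence "(2 ^ p - 1) * zeta (of_nat p) =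
           - ((-1) ^ m * of_real pi ^ (2 * m) * of_real H) + \<i> / of_real pi * suminf t"
    by (simp add: L(2))
  with summable show ?thesis
    unfolding digamma_sum[OF assms] t_def p_def H_def by blast
qed

end
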